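(* Let $A\in\mathbb{R}^{m\times n}$, $b\in\mathbb{R}^m$ and $\ell,u\in\mathbb{R}^n$ with $\ell\le0\le u$, and consider the ResQPASS iteration described in the context, with $y_k\in\mathbb{R}^k$ and $\lambda_k,\mu_k\in\mathbb{R}^n$ the solution of the projected KKT conditions at iteration $k$. Let $k_0>0$ be an iteration such that $-\lambda_k+\mu_k\in\mathrm{span}([V_{k_0},A^TAV_{k_0-1}])$ for all iterations $k\ge k_0$. Then for every iteration $k\ge k_0$ there are vectors $\gamma_j^{(k)}\in\mathbb{R}^{k_0}$, $j\in\{0,\ldots,k-k_0+1\}$, such that $$r_k=A^T(AV_ky_k-b)-\lambda_k+\mu_k=\sum_{j=0}^{k-k_0+1}(A^TA)^jV_{k_0}\gamma_j^{(k)} .$$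
   Context: ResQPASS iteration: inequalities between vectors are componentwise. Start with $x_0=0$, $\lambda_0=\mu_0=0$, $r_0=-A^Tb$. For $k\ge1$ let $V_k\in\mathbb{R}^{n\times k}$ be the matrix with columns $v_j=r_{j-1}/\|r_{j-1}\|_2$, $j=1,\dots,k$ (iterations are considered only as long as the residuals $r_0,\dots,r_{k-1}$ are nonzero, so that $V_k$ is defined; $V_0$ is the empty matrix). Let $x_k=V_ky_k$ where $y_k\in\mathbb{R}^k$ solves $\min_{y}\frac12\|AV_ky-b\|_2^2$ s.t. $\ell\le V_ky\le u$, and let $\lambda_k,\mu_k\in\mathbb{R}^n$ be associated Lagrange multipliers of the lower and upper bounds, i.e. the projected KKT conditions hold: $V_k^TA^T(AV_ky_k-b)-V_k^T\lambda_k+V_k^T\mu_k=0$; $(\lambda_k)_i([V_ky_k]_i-\ell_i)=0$ and $(\mu_k)_i(u_i-[V_ky_k]_i)=0$ for all $i$; $\ell\le V_ky_k\le u$; $\lambda_k,\mu_k\ge0$. Then set $r_k=A^T(Ax_k-b)-\lambda_k+\mu_k$. For a block matrix, $\mathrm{span}([X,Y])$ denotes the span of all columns of $X$ and $Y$. *)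

theory Defs
  imports "HOL-Analysis.Analysis"
begin

text \<open>
  The number of columns of \<open>V\<^sub>k\<close> varies with \<open>k\<close>, so a matrix with \<open>k\<close> columns in \<open>\<real>\<^sup>n\<close> is given
  by its column sequence \<open>V :: nat \<Rightarrow> real ^ 'n\<close>, of which only the entries \<open>1, \<dots>, k\<close> are used;
  likewise a vector of \<open>\<real>\<^sup>k\<close> is a function \<open>nat \<Rightarrow> real\<close> of which only the entries \<open>1, \<dots>, k\<close>
  are used. The residual sequence \<open>r\<close> determines all the \<open>V\<^sub>k\<close>.
\<close>

definition V_col :: "(nat \<Rightarrow> real ^ 'n) \<Rightarrow> nat \<Rightarrow> real ^ 'n" where
  "V_col r j = r (j - 1) /\<^sub>R norm (r (j - 1))"

definition V_cols :: "(nat \<Rightarrow> real ^ 'n) \<Rightarrow> nat \<Rightarrow> (real ^ 'n) set" where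
  "V_cols r k = V_col r ` {1..k}"

text \<open>The product \<open>V\<^sub>k y\<close>.\<close>

definition V_mult :: "(nat \<Rightarrow> real ^ 'n) \<Rightarrow> nat \<Rightarrow> (nat \<Rightarrow> real) \<Rightarrow> real ^ 'n" where
  "V_mult r k y = (\<Sum>j = 1..k. y j *\<^sub>R V_col r j)"

text \<open>The \<open>j\<close>-th entry of \<open>V\<^sub>k\<^sup>T w\<close>, for \<open>j \<in> {1..k}\<close>.\<close>

definition Vt_mult :: "(nat \<Rightarrow> real ^ 'n) \<Rightarrow> real ^ 'n \<Rightarrow> nat \<Rightarrow> real" where
  "Vt_mult r w j = V_col r j \<bullet> w"

text \<open>
  The power of a square matrix with respect to \<open>**\<close>. (On the type \<open>real ^ 'n ^ 'n\<close> the operator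
  \<open>^\<close> is the componentwise power.)
\<close>

primrec mat_pow :: "real ^ 'n ^ 'n \<Rightarrow> nat \<Rightarrow> real ^ 'n ^ 'n" where
  "mat_pow M 0 = mat 1"
| "mat_pow M (Suc j) = M ** mat_pow M j"

definition proj_solution ::
  "real ^ 'n ^ 'm \<Rightarrow> real ^ 'm \<Rightarrow> real ^ 'n \<Rightarrow> real ^ 'n \<Rightarrow> (nat \<Rightarrow> real ^ 'n) \<Rightarrow> nat
    \<Rightarrow> (nat \<Rightarrow> real) \<Rightarrow> bool" where
  "proj_solution A b l u r k y \<longleftrightarrow>
     l \<le> V_mult r k y \<and> V_mult r k y \<le> u \<and>
     (\<forall>z. l \<le> V_mult r k z \<and> V_mult r k z \<le> u \<longrightarrow>
        1/2 * (norm (A *v V_mult r k y - b))\<^sup>2 \<le> 1/2 * (norm (A *v V_mult r k z - b))\<^sup>2)"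

definition proj_KKT ::
  "real ^ 'n ^ 'm \<Rightarrow> real ^ 'm \<Rightarrow> real ^ 'n \<Rightarrow> real ^ 'n \<Rightarrow> (nat \<Rightarrow> real ^ 'n) \<Rightarrow> nat
    \<Rightarrow> (nat \<Rightarrow> real) \<Rightarrow> real ^ 'n \<Rightarrow> real ^ 'n \<Rightarrow> bool" where
  "proj_KKT A b l u r k y lam mu \<longleftrightarrow>
     (\<forall>j\<in>{1..k}. Vt_mult r (transpose A *v (A *v V_mult r k y - b)) j
                  - Vt_mult r lam j + Vt_mult r mu j = 0) \<and>
     (\<forall>i. lam $ i * (V_mult r k y $ i - l $ i) = 0) \<and>
     (\<forall>i. mu $ i * (u $ i - V_mult r k y $ i) = 0) \<and>
     l \<le> V_mult r k y \<and> V_mult r k y \<le> u \<and>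
     0 \<le> lam \<and> 0 \<le> mu"

text \<open>Iteration \<open>k\<close> takes place iff \<open>V\<^sub>k\<close> is defined.\<close>

definition is_iteration :: "(nat \<Rightarrow> real ^ 'n) \<Rightarrow> nat \<Rightarrow> bool" where
  "is_iteration r k \<longleftrightarrow> (\<forall>j<k. r j \<noteq> 0)"

text \<open>
  The sequences are total functions on \<open>nat\<close>; their values at indices \<open>k\<close> that are not iterations
  are unconstrained.
\<close>

definition resqpass ::
  "real ^ 'n ^ 'm \<Rightarrow> real ^ 'm \<Rightarrow> real ^ 'n \<Rightarrow> real ^ 'n \<Rightarrow> (nat \<Rightarrow> real ^ 'n)
    \<Rightarrow> (nat \<Rightarrow> nat \<Rightarrow> real) \<Rightarrow> (nat \<Rightarrow> real ^ 'n) \<Rightarrow> (nat \<Rightarrow> real ^ 'n) \<Rightarrow> (nat \<Rightarrow> real ^ 'n)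
    \<Rightarrow> bool" where
  "resqpass A b l u x y lam mu r \<longleftrightarrow>
     x 0 = 0 \<and> lam 0 = 0 \<and> mu 0 = 0 \<and> r 0 = - (transpose A *v b) \<and>
     (\<forall>k\<ge>1. is_iteration r k \<longrightarrow>
        proj_solution A b l u r k (y k) \<and>
        proj_KKT A b l u r k (y k) (lam k) (mu k) \<and>
        x k = V_mult r k (y k) \<and>
        r k = transpose A *v (A *v x k - b) - lam k + mu k)"

end

theory Submission
  imports Defs
begin

text \<open>
  Write \<open>M = A\<^sup>T A\<close> and let \<open>K\<^sub>p\<close> be the block Krylov space of all sums
  \<open>\<Sum>j\<le>p. M\<^sup>j c\<^sub>j\<close> with \<open>c\<^sub>j\<close> in the column space of \<open>V\<^bsub>k\<^sub>0\<^esub>\<close>. The spaces \<open>K\<^sub>p\<close> increase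
  with \<open>p\<close>, and \<open>M\<close> maps \<open>K\<^sub>p\<close> into \<open>K\<^bsub>p+1\<^esub>\<close>. Strong induction shows
  \<open>r\<^sub>k \<in> K\<^bsub>k - k\<^sub>0 + 1\<^esub>\<close> for every iteration \<open>k \<ge> k\<^sub>0\<close>. In
  \<open>r\<^sub>k = M V\<^sub>k y\<^sub>k - A\<^sup>T b + (- \<lambda>\<^sub>k + \<mu>\<^sub>k)\<close> the term \<open>- A\<^sup>T b = r\<^sub>0\<close> is a multiple of the
  first column of \<open>V\<^bsub>k\<^sub>0\<^esub>\<close>, the multiplier term is in \<open>K\<^sub>1\<close> by hypothesis, and the columns of
  \<open>V\<^sub>k\<close> are columns of \<open>V\<^bsub>k\<^sub>0\<^esub>\<close> or normalised residuals \<open>r\<^sub>i\<close> with \<open>k\<^sub>0 \<le> i < k\<close>, which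
  are in \<open>K\<^bsub>k - k\<^sub>0\<^esub>\<close> by induction; applying \<open>M\<close> to their combination \<open>V\<^sub>k y\<^sub>k\<close> costs one
  more power. The vectors \<open>\<gamma>\<^sub>j\<close> are then coefficients of the \<open>c\<^sub>j\<close> in the columns of
  \<open>V\<^bsub>k\<^sub>0\<^esub>\<close>.
\<close>

text \<open>
  Explicit sums, rather than the span of the sets \<open>M\<^sup>j S\<close>, keep one summand from \<open>S\<close> for each
  power of \<open>M\<close>, from which the coefficient vectors are read off.
\<close>

definition block_krylov :: "real ^ 'n ^ 'n \<Rightarrow> (real ^ 'n) set \<Rightarrow> nat \<Rightarrow> (real ^ 'n) set" where
  "block_krylov M S p = {\<Sum>j = 0..p. mat_pow M j *v c j | c. \<forall>j. c j \<in> S}"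

lemma subspace_block_krylov:
  assumes "subspace S"
  shows "subspace (block_krylov M S p)"
proof (rule subspaceI)
  show "0 \<in> block_krylov M S p"
    using subspace_0[OF assms] unfolding block_krylov_def
    by (auto intro!: exI[of _ "\<lambda>_. 0"])
next
  fix v w assume "v \<in> block_krylov M S p" "w \<in> block_krylov M S p"
  then obtain c d where "\<forall>j. c j \<in> S" "\<forall>j. d j \<in> S"
    and "v = (\<Sum>j = 0..p. mat_pow M j *v c j)" "w = (\<Sum>j = 0..p. mat_pow M j *v d j)"
    unfolding block_krylov_def by blast
  then show "v + w \<in> block_krylov M S p"
    using subspace_add[OF assms] unfolding block_krylov_def
    by (auto intro!: exI[of _ "\<lambda>j. c j + d j"]
        simp: matrix_vector_right_distrib sum.distrib)
next
  fix a v assume "v \<in> block_krylov M S p"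
  then obtain c where "\<forall>j. c j \<in> S" and "v = (\<Sum>j = 0..p. mat_pow M j *v c j)"
    unfolding block_krylov_def by blast
  then show "a *\<^sub>R v \<in> block_krylov M S p"
    using subspace_scale[OF assms] unfolding block_krylov_def
    by (auto intro!: exI[of _ "\<lambda>j. a *\<^sub>R c j"]
        simp: matrix_vector_mult_scaleR scaleR_sum_right)
qed

lemma block_krylov_mono:
  assumes "0 \<in> S" and "p \<le> q"
  shows "block_krylov M S p \<subseteq> block_krylov M S q"
proof
  fix v assume "v \<in> block_krylov M S p"
  then obtain c where c: "\<forall>j. c j \<in> S" and v: "v = (\<Sum>j = 0..p. mat_pow M j *v c j)"
    unfolding block_krylov_def by blast
  have "v = (\<Sum>j = 0..q. mat_pow M j *v (if j \<le> p then c j else 0))"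
    unfolding v using assms(2) by (intro sum.mono_neutral_cong_left) auto
  then show "v \<in> block_krylov M S q"
    using c assms(1) unfolding block_krylov_def
    by (auto intro!: exI[of _ "\<lambda>j. if j \<le> p then c j else 0"])
qed

lemma block_krylov_0: "block_krylov M S 0 = S"
  unfolding block_krylov_def by (auto intro: exI[of _ "\<lambda>_. v" for v])

lemma subset_block_krylov:
  assumes "0 \<in> S"
  shows "S \<subseteq> block_krylov M S p"
  using block_krylov_mono[OF assms, of 0 p M] by (simp add: block_krylov_0)

lemma mult_block_krylov:
  assumes "0 \<in> S" and "v \<in> block_krylov M S p"
  shows "M *v v \<in> block_krylov M S (Suc p)"
proof -
  obtain c where c: "\<forall>j. c j \<in> S" and v: "v = (\<Sum>j = 0..p. mat_pow M j *v c j)"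
    using assms(2) unfolding block_krylov_def by blast
  let ?d = "\<lambda>j. case j of 0 \<Rightarrow> 0 | Suc i \<Rightarrow> c i"
  have "M *v v = (\<Sum>j = 0..p. mat_pow M (Suc j) *v ?d (Suc j))"
    unfolding v by (simp add: linear_sum[OF matrix_vector_mul_linear] matrix_vector_mul_assoc)
  also have "\<dots> = (\<Sum>j = 0..Suc p. mat_pow M j *v ?d j)"
    by (subst sum.atLeast0_atMost_Suc_shift) simp
  finally show ?thesis
    using c assms(1) unfolding block_krylov_def
    by (auto intro!: exI[of _ ?d] split: nat.split)
qed

lemma span_V_cols: "span (V_cols r k) = range (V_mult r k)"
proof
  have "subspace (range (V_mult r k))"
  proof (rule subspaceI)
    show "0 \<in> range (V_mult r k)"
      by (rule range_eqI[of _ _ "\<lambda>_. 0"]) (simp add: V_mult_def)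
  next
    fix v w assume "v \<in> range (V_mult r k)" "w \<in> range (V_mult r k)"
    then obtain f g where "v = V_mult r k f" "w = V_mult r k g" by blast
    then show "v + w \<in> range (V_mult r k)"
      by (intro range_eqI[of _ _ "\<lambda>j. f j + g j"])
        (simp add: V_mult_def scaleR_add_left sum.distrib)
  next
    fix a v assume "v \<in> range (V_mult r k)"
    then obtain f where "v = V_mult r k f" by blast
    then show "a *\<^sub>R v \<in> range (V_mult r k)"
      by (intro range_eqI[of _ _ "\<lambda>j. a * f j"]) (simp add: V_mult_def scaleR_sum_right)
  qed
  moreover have "V_col r i \<in> range (V_mult r k)" if "i \<in> {1..k}" for i
    using that
    by (intro range_eqI[of _ _ "\<lambda>j. if j = i then 1 else 0"])
      (simp add: V_mult_def if_distrib[of "\<lambda>a. a *\<^sub>R _"] cong: if_cong)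
  ultimately show "span (V_cols r k) \<subseteq> range (V_mult r k)"
    unfolding V_cols_def by (intro span_minimal) auto
  show "range (V_mult r k) \<subseteq> span (V_cols r k)"
    unfolding V_mult_def V_cols_def
    by (intro image_subsetI span_sum span_scale span_base imageI)
qed

lemma V_cols_mono: "k \<le> k' \<Longrightarrow> V_cols r k \<subseteq> V_cols r k'"
  unfolding V_cols_def by auto

lemma is_iteration_mono: "is_iteration r k \<Longrightarrow> i \<le> k \<Longrightarrow> is_iteration r i"
  unfolding is_iteration_def by auto

text \<open>
  A column of \<open>V\<^sub>k\<close> is a column of \<open>V\<^bsub>k\<^sub>0\<^esub>\<close> or a multiple of a later residual, to which an
  induction hypothesis applies.
\<close>

lemma V_mult_in_subspace:
  assumes "subspace T" and "V_cols r k0 \<subseteq> T" and "\<And>i. k0 \<le> i \<Longrightarrow> i < k \<Longrightarrow> r i \<in> T"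
  shows "V_mult r k y \<in> T"
  unfolding V_mult_def
proof (rule subspace_sum[OF assms(1)])
  fix j assume j: "j \<in> {1..k}"
  have "V_col r j \<in> T"
  proof (cases "j \<le> k0")
    case True
    then show ?thesis using j assms(2) unfolding V_cols_def by auto
  next
    case False
    then show ?thesis
      using j assms(3)[of "j - 1"] subspace_scale[OF assms(1)] unfolding V_col_def by auto
  qed
  then show "y j *\<^sub>R V_col r j \<in> T" by (rule subspace_scale[OF assms(1)])
qed

lemma initial_residual_in_span:
  assumes "k > 0" and "is_iteration r k"
  shows "r 0 \<in> span (V_cols r k)"
proof -
  have "r 0 = norm (r 0) *\<^sub>R V_col r 1"
    using assms unfolding V_col_def is_iteration_def by simp
  moreover have "V_col r 1 \<in> V_cols r k"
    using assms(1) unfolding V_cols_def by auto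
  ultimately show ?thesis by (metis span_base span_scale)
qed

text \<open>
  Passing from the columns of \<open>V\<^sub>k\<close> to \<open>r k\<close> multiplies by \<open>M\<close> once, so the power of \<open>M\<close> that is
  needed grows by at most one per iteration. The perturbation \<open>g k\<close>, which stands for
  \<open>- \<lambda>\<^sub>k + \<mu>\<^sub>k\<close>, contributes powers at most one throughout.
\<close>

lemma residual_in_block_krylov:
  fixes A :: "real ^ 'n ^ 'm" and r :: "nat \<Rightarrow> real ^ 'n"
  defines "M \<equiv> transpose A ** A"
  assumes r0: "r 0 = - (transpose A *v b)"
    and rec: "\<And>k. k \<ge> k0 \<Longrightarrow> is_iteration r k \<Longrightarrow>
                r k = transpose A *v (A *v V_mult r k (y k) - b) + g k"
    and k0: "k0 > 0" "is_iteration r k0"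
    and g: "\<And>k. k \<ge> k0 \<Longrightarrow> is_iteration r k \<Longrightarrow>
              g k \<in> span (V_cols r k0 \<union> (\<lambda>v. M *v v) ` V_cols r (k0 - 1))"
    and "k \<ge> k0" and "is_iteration r k"
  shows "r k \<in> block_krylov M (span (V_cols r k0)) (k - k0 + 1)"
  using assms(7,8)
proof (induction k rule: less_induct)
  case (less k)
  let ?S = "span (V_cols r k0)"
  let ?K = "block_krylov M ?S"
  have K: "subspace (?K p)" for p by (intro subspace_block_krylov subspace_span)
  have S0: "0 \<in> ?S" by (rule span_zero)
  have S: "?S \<subseteq> ?K p" for p by (rule subset_block_krylov[OF S0])
  have mono: "?K p \<subseteq> ?K q" if "p \<le> q" for p q by (rule block_krylov_mono[OF S0 that])
  have "r i \<in> ?K (k - k0)" if "k0 \<le> i" "i < k" for i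
  proof -
    have "r i \<in> ?K (i - k0 + 1)"
      using less.IH[OF that(2,1)] is_iteration_mono[OF less.prems(2)] that by simp
    moreover have "i - k0 + 1 \<le> k - k0" using that by linarith
    ultimately show ?thesis using mono by blast
  qed
  then have "V_mult r k (y k) \<in> ?K (k - k0)"
    by (intro V_mult_in_subspace[OF K order_trans[OF span_superset S]])
  then have "M *v V_mult r k (y k) \<in> ?K (k - k0 + 1)"
    using mult_block_krylov[OF S0] by simp
  moreover have "r 0 \<in> ?K (k - k0 + 1)"
    using initial_residual_in_span[OF k0] S by blast
  moreover have "g k \<in> ?K (k - k0 + 1)"
  proof -
    have "V_cols r (k0 - 1) \<subseteq> ?K 0"
      using V_cols_mono[of "k0 - 1" k0 r] order_trans[OF span_superset S] by fastforce
    then have "(\<lambda>v. M *v v) ` V_cols r (k0 - 1) \<subseteq> ?K 1"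
      using mult_block_krylov[OF S0, of _ M 0] by auto
    then have "span (V_cols r k0 \<union> (\<lambda>v. M *v v) ` V_cols r (k0 - 1)) \<subseteq> ?K 1"
      using order_trans[OF span_superset S] by (intro span_minimal K Un_least)
    then show ?thesis using g[OF less.prems] mono[of 1 "k - k0 + 1"] by auto
  qed
  moreover have "r k = M *v V_mult r k (y k) + r 0 + g k"
    unfolding rec[OF less.prems] r0 M_def
    by (simp add: matrix_vector_mult_diff_distrib matrix_vector_mul_assoc)
  ultimately show ?case by (simp add: subspace_add[OF K])
qed

theorem lemma2p7:
  fixes A :: "real ^ 'n ^ 'm" and b :: "real ^ 'm" and l u :: "real ^ 'n"
    and x lam mu r :: "nat \<Rightarrow> real ^ 'n" and y :: "nat \<Rightarrow> nat \<Rightarrow> real" and k0 :: nat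
  assumes "l \<le> 0" and "0 \<le> u"
    and "resqpass A b l u x y lam mu r"
    and "k0 > 0" and "is_iteration r k0"
    and "\<And>k. k \<ge> k0 \<Longrightarrow> is_iteration r k \<Longrightarrow>
           - lam k + mu k \<in>
             span (V_cols r k0 \<union> (\<lambda>v. (transpose A ** A) *v v) ` V_cols r (k0 - 1))"
  shows "\<forall>k\<ge>k0. is_iteration r k \<longrightarrow>
           (\<exists>\<gamma> :: nat \<Rightarrow> nat \<Rightarrow> real.
              r k = transpose A *v (A *v V_mult r k (y k) - b) - lam k + mu k \<and>
              r k = (\<Sum>j = 0..k - k0 + 1.
                       mat_pow (transpose A ** A) j *v V_mult r k0 (\<gamma> j)))"
proof (intro allI impI)
  fix k assume k: "k \<ge> k0" "is_iteration r k"
  let ?M = "transpose A ** A"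
  have rec: "r i = transpose A *v (A *v V_mult r i (y i) - b) - lam i + mu i"
    if "i \<ge> k0" "is_iteration r i" for i
    using assms(3,4) that unfolding resqpass_def by auto
  have "r k \<in> block_krylov ?M (span (V_cols r k0)) (k - k0 + 1)"
  proof (rule residual_in_block_krylov[where g = "\<lambda>i. - lam i + mu i" and y = y and b = b])
    show "r 0 = - (transpose A *v b)" using assms(3) unfolding resqpass_def by simp
  qed (use rec assms(4-6) k in auto)
  then obtain c where "\<forall>j. c j \<in> range (V_mult r k0)"
    and rk: "r k = (\<Sum>j = 0..k - k0 + 1. mat_pow ?M j *v c j)"
    unfolding block_krylov_def span_V_cols by blast
  then have "\<forall>j. \<exists>f. c j = V_mult r k0 f" by blast
  then obtain \<gamma> where "\<forall>j. c j = V_mult r k0 (\<gamma> j)"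
    by (rule choice[THEN exE])
  then have "r k = (\<Sum>j = 0..k - k0 + 1. mat_pow ?M j *v V_mult r k0 (\<gamma> j))"
    unfolding rk by (intro sum.cong) simp_all
  with rec[OF k] show "\<exists>\<gamma> :: nat \<Rightarrow> nat \<Rightarrow> real.
      r k = transpose A *v (A *v V_mult r k (y k) - b) - lam k + mu k \<and>
      r k = (\<Sum>j = 0..k - k0 + 1. mat_pow ?M j *v V_mult r k0 (\<gamma> j))"
    by blast
qed

end
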